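(* Let $q\in(0,1)$. For each $f \in C[0,1]$, the function $x\mapsto (D_{\infty,q}f)(x)$ admits an analytic continuation from $[0,1]$ to the whole complex plane $\mathbb{C}$ as an entire function, given by $$(D_{\infty,q}f)(z)=\sum_{j=0}^{\infty} \frac{f(q^j)q^j}{(q;q)_j} \sum_{n=0}^{\infty} \frac{(-1)^n q^{n(n+1)/2}}{(q;q)_n} (z;q)_{n+j},\qquad z\in\mathbb{C}.$$
   Context: For $a\in\mathbb{C}$ and $0<q<1$, the $q$-Pochhammer symbols are $(a;q)_0=1$, $(a;q)_n=\prod_{j=0}^{n-1}(1-aq^j)$, $(a;q)_\infty=\prod_{j=0}^{\infty}(1-aq^j)$. The limit $q$-Durrmeyer operator is defined for $f\in C[0,1]$ by $(D_{\infty,q}f)(x)=\sum_{k=0}^{\infty} A_{\infty k}(f)\, p_{\infty k}(q;x)$ for $x\in[0,1)$ and $(D_{\infty,q}f)(1)=f(1)$, where $p_{\infty k}(q;x)=\frac{(x;q)_\infty\, x^k}{(q;q)_k}$ and $A_{\infty k}(f)=\frac{q^{-k}}{1-q}\int_0^1 f(t)\,p_{\infty k}(q;qt)\,d_qt$. Here the $q$-integral is $\int_0^a h(t)\,d_qt=(1-q)a\sum_{j=0}^\infty q^j h(aq^j)$. Equivalently, $A_{\infty k}(f)=\frac{(q;q)_\infty}{(q;q)_k}\sum_{j=0}^\infty \frac{f(q^j)q^{(k+1)j}}{(q;q)_j}$. *)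

theory Defs
  imports "HOL-Complex_Analysis.Complex_Analysis"
begin

definition q_pochhammer :: "complex \<Rightarrow> real \<Rightarrow> nat \<Rightarrow> complex" where
  "q_pochhammer a q n = (\<Prod>j<n. 1 - a * complex_of_real q ^ j)"

definition q_pochhammer_inf :: "complex \<Rightarrow> real \<Rightarrow> complex" where
  "q_pochhammer_inf a q = (\<Prod>j. 1 - a * complex_of_real q ^ j)"

text \<open>The Jackson integral of \<open>h\<close> over \<open>[0, a]\<close>.\<close>

definition q_integral :: "real \<Rightarrow> real \<Rightarrow> (real \<Rightarrow> complex) \<Rightarrow> complex" where
  "q_integral q a h =
     complex_of_real ((1 - q) * a) * (\<Sum>j. complex_of_real (q ^ j) * h (a * q ^ j))"

definition limit_q_basis :: "real \<Rightarrow> nat \<Rightarrow> real \<Rightarrow> complex" where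
  "limit_q_basis q k x =
     q_pochhammer_inf (complex_of_real x) q * complex_of_real x ^ k
       / q_pochhammer (complex_of_real q) q k"

definition limit_q_Durrmeyer_coeff :: "real \<Rightarrow> nat \<Rightarrow> (real \<Rightarrow> complex) \<Rightarrow> complex" where
  "limit_q_Durrmeyer_coeff q k f =
     complex_of_real (q powi (- int k) / (1 - q))
       * q_integral q 1 (\<lambda>t. f t * limit_q_basis q k (q * t))"

text \<open>Only the values at \<open>x \<in> [0, 1]\<close> are meaningful.  The case \<open>x = 1\<close> is separate
  because the series there is identically zero.\<close>

definition limit_q_Durrmeyer :: "real \<Rightarrow> (real \<Rightarrow> complex) \<Rightarrow> real \<Rightarrow> complex" where
  "limit_q_Durrmeyer q f x =
     (if x = 1 then f 1
      else (\<Sum>k. limit_q_Durrmeyer_coeff q k f * limit_q_basis q k x))"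

end

theory Submission
  imports Defs
begin

text \<open>Inserting the definition of the coefficients gives, on \<open>[0, 1)\<close>, a double series over
  \<open>k\<close> and \<open>j\<close>.  After interchanging the sums, the inner sum over \<open>k\<close> is turned by Euler's two
  expansions of \<open>(z; q)\<^sub>\<infinity>\<close> and \<open>1 / (z; q)\<^sub>\<infinity>\<close> into the inner sum of the claimed formula, which
  makes sense for all \<open>z\<close>.  It is entire in \<open>z\<close> and locally bounded uniformly in \<open>j\<close>, because
  \<open>|(z; q)\<^sub>n| \<le> exp (|z| / (1 - q))\<close>, so the outer series, dominated by a geometric one, is
  entire as well.\<close>

section \<open>Interchange of dominated series and entire series\<close>

text \<open>A product majorant with summable factors makes the family absolutely summable over all
  pairs, so Fubini for \<open>infsum\<close> applies. The remaining work is the passage between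
  \<open>suminf\<close> and \<open>infsum\<close>.\<close>

lemma suminf_swap_dominated:
  fixes a :: "nat \<Rightarrow> nat \<Rightarrow> 'a :: banach"
  assumes bound: "\<And>i j. norm (a i j) \<le> u i * v j"
    and u: "summable u" "\<And>i. 0 \<le> u i" and v: "summable v" "\<And>j. 0 \<le> v j"
  shows "(\<Sum>i. \<Sum>j. a i j) = (\<Sum>j. \<Sum>i. a i j)"
proof -
  have row: "summable (\<lambda>j. norm (a i j))" for i
    by (rule summable_comparison_test'[OF summable_mult[OF v(1), of "u i"]])
       (simp add: bound)
  have col: "summable (\<lambda>i. norm (a i j))" for j
    by (rule summable_comparison_test'[OF summable_mult2[OF u(1), of "v j"]])
       (simp add: bound)
  have row_le: "(\<Sum>j. norm (a i j)) \<le> u i * suminf v" for i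
  proof -
    have "(\<Sum>j. norm (a i j)) \<le> (\<Sum>j. u i * v j)"
      by (intro suminf_le bound row summable_mult v)
    then show ?thesis using v(1) by (simp add: suminf_mult)
  qed
  have row_summable: "summable (\<lambda>i. norm (\<Sum>j. norm (a i j)))"
    by (rule summable_comparison_test'[OF summable_mult2[OF u(1), of "suminf v"]])
       (simp add: row_le suminf_nonneg row)
  \<comment> \<open>The two notions of sum agree under absolute convergence. This is applied to
    rows, columns and both outer series, so each of these needs its own absolute
    summability.\<close>
  have eq_infsum: "infsum g UNIV = suminf g" if "summable (\<lambda>n. norm (g n))"
    for g :: "nat \<Rightarrow> 'b :: banach"
    by (rule infsumI, rule norm_summable_imp_has_sum[OF that summable_sums[OF summable_norm_cancel[OF that]]])
  have abs: "(\<lambda>p. norm (case p of (i,j) \<Rightarrow> a i j)) summable_on UNIV \<times> UNIV"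
    unfolding Infinite_Sum.abs_summable_on_Sigma_iff
  proof (intro conjI ballI)
    show "(\<lambda>y. norm (case (i, y) of (i, j) \<Rightarrow> a i j)) summable_on UNIV" for i
      using row[of i] by (auto intro!: norm_summable_imp_summable_on)
    have "(\<Sum>\<^sub>\<infinity>j. norm (a i j)) = (\<Sum>j. norm (a i j))" for i
      using row[of i] by (intro eq_infsum) simp
    then show "(\<lambda>i. norm (\<Sum>\<^sub>\<infinity>j. norm (case (i, j) of (i, j) \<Rightarrow> a i j))) summable_on UNIV"
      using row_summable by (auto intro!: norm_summable_imp_summable_on)
  qed
  have row_sums: "summable (\<lambda>i. norm (\<Sum>j. a i j))"
    by (rule summable_comparison_test'[OF row_summable])
       (simp add: suminf_nonneg row summable_norm)
  have col_sums: "summable (\<lambda>j. norm (\<Sum>i. a i j))"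
  proof (rule summable_comparison_test'[OF summable_mult[OF v(1), of "suminf u"]])
    fix j
    have "norm (\<Sum>i. a i j) \<le> (\<Sum>i. norm (a i j))" by (rule summable_norm[OF col])
    also have "\<dots> \<le> (\<Sum>i. u i * v j)" by (intro suminf_le bound col summable_mult2 u)
    also have "\<dots> = suminf u * v j" using u(1) by (simp add: suminf_mult2)
    finally show "norm (norm (\<Sum>i. a i j)) \<le> suminf u * v j" by simp
  qed
  have "(\<Sum>\<^sub>\<infinity>i. \<Sum>\<^sub>\<infinity>j. a i j) = (\<Sum>\<^sub>\<infinity>j. \<Sum>\<^sub>\<infinity>i. a i j)"
    by (rule infsum_swap_banach) (rule abs_summable_summable[OF abs])
  then show ?thesis
    by (simp add: eq_infsum row col row_sums col_sums)
qed

text \<open>The M-test on the closed unit disc around each point gives locally uniform convergence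
  of the partial sums, which preserves holomorphy. The majorant may depend on the radius
  \<open>R\<close>.\<close>

lemma entire_suminf:
  fixes f :: "nat \<Rightarrow> complex \<Rightarrow> complex"
  assumes hol: "\<And>n. f n holomorphic_on UNIV"
    and bound: "\<And>R. \<exists>M. summable M \<and> (\<forall>n z. norm z \<le> R \<longrightarrow> norm (f n z) \<le> M n)"
  shows "(\<lambda>z. \<Sum>n. f n z) holomorphic_on UNIV"
proof (rule holomorphic_uniform_sequence[where f = "\<lambda>n z. \<Sum>i<n. f i z"])
  fix z :: complex
  obtain M where M: "summable M" "\<And>n w. norm w \<le> norm z + 1 \<Longrightarrow> norm (f n w) \<le> M n"
    using bound[of "norm z + 1"] by blast
  have "norm w \<le> norm z + 1" if "w \<in> cball z 1" for w
    using that norm_triangle_sub[of w z] by (simp add: dist_norm norm_minus_commute)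
  then have "uniform_limit (cball z 1) (\<lambda>n z. \<Sum>i<n. f i z) (\<lambda>z. \<Sum>n. f n z) sequentially"
    using M by (intro Weierstrass_m_test) auto
  then show "\<exists>d>0. cball z d \<subseteq> UNIV \<and>
      uniform_limit (cball z d) (\<lambda>n z. \<Sum>i<n. f i z) (\<lambda>z. \<Sum>n. f n z) sequentially"
    by (intro exI[of _ 1]) auto
qed (auto intro!: holomorphic_intros hol)

section \<open>The q-Pochhammer symbols\<close>

lemma q_pochhammer_0 [simp]: "q_pochhammer a q 0 = 1"
  by (simp add: q_pochhammer_def)

lemma q_pochhammer_Suc:
  "q_pochhammer a q (Suc n) = q_pochhammer a q n * (1 - a * complex_of_real q ^ n)"
  by (simp add: q_pochhammer_def)

lemma q_pochhammer_add:
  "q_pochhammer a q (m + n) = q_pochhammer a q m * q_pochhammer (a * complex_of_real q ^ m) q n"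
  by (induction n) (simp_all add: q_pochhammer_Suc power_add mult.assoc)

lemma holomorphic_q_pochhammer [holomorphic_intros]:
  "(\<lambda>z. q_pochhammer z q n) holomorphic_on S"
  unfolding q_pochhammer_def by (intro holomorphic_intros)

text \<open>The factor of index 0 is \<open>1 - 1\<close>. This is what isolates \<open>f 1\<close>
  at the endpoint \<open>z = 1\<close>.\<close>

lemma q_pochhammer_one_Suc: "q_pochhammer 1 q (Suc n) = 0"
  unfolding q_pochhammer_def prod.lessThan_Suc_shift by simp

text \<open>These are the Taylor coefficients of \<open>(q z; q)\<^sub>\<infinity>\<close> in
  \<open>z\<close>; the exponent is \<open>n(n+1)/2\<close> instead of Euler's
  \<open>n(n-1)/2\<close> because of the shift from \<open>z\<close> to \<open>q z\<close>.\<close>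

definition q_euler_coeff :: "real \<Rightarrow> nat \<Rightarrow> complex" where
  "q_euler_coeff q n =
     (-1) ^ n * complex_of_real (q ^ (n * (n + 1) div 2)) / q_pochhammer (complex_of_real q) q n"

lemma q_euler_coeff_0 [simp]: "q_euler_coeff q 0 = 1"
  by (simp add: q_euler_coeff_def)

definition q_Durrmeyer_kernel :: "real \<Rightarrow> nat \<Rightarrow> complex \<Rightarrow> complex" where
  "q_Durrmeyer_kernel q j z = (\<Sum>n. q_euler_coeff q n * q_pochhammer z q (n + j))"

text \<open>The weight carries the dependence on \<open>f\<close> and the decay in \<open>j\<close>;
  the kernel carries the dependence on \<open>z\<close>.\<close>

definition q_Durrmeyer_weight :: "real \<Rightarrow> (real \<Rightarrow> complex) \<Rightarrow> nat \<Rightarrow> complex" where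
  "q_Durrmeyer_weight q f j =
     f (q ^ j) * complex_of_real (q ^ j) / q_pochhammer (complex_of_real q) q j"

section \<open>Nonvanishing, convergence and bounds for fixed \<open>0 < q < 1\<close>\<close>

context
  fixes q :: real
  assumes q: "0 < q" "q < 1"
begin

lemma q_power_neq_1: "norm a < 1 \<Longrightarrow> a * complex_of_real q ^ n \<noteq> 1"
proof
  assume "norm a < 1" and eq: "a * complex_of_real q ^ n = 1"
  have "norm (a * complex_of_real q ^ n) \<le> norm a * 1"
    unfolding norm_mult norm_power using q by (intro mult_left_mono power_le_one) auto
  then show False using eq \<open>norm a < 1\<close> by simp
qed

lemma q_pochhammer_nonzero: "norm a < 1 \<Longrightarrow> q_pochhammer a q n \<noteq> 0"
  using q_power_neq_1[of a] by (auto simp: q_pochhammer_def)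

lemma q_pochhammer_q_nonzero [simp]: "q_pochhammer (complex_of_real q) q n \<noteq> 0"
  using q by (intro q_pochhammer_nonzero) simp

text \<open>The deviations from 1 form a geometric series. Every complex \<open>a\<close> is
  allowed, since \<open>convergent_prod\<close> tolerates finitely many zero factors.\<close>

lemma convergent_prod_q_pochhammer: "convergent_prod (\<lambda>j. 1 - a * complex_of_real q ^ j)"
  using q by (intro abs_convergent_prod_imp_convergent_prod summable_imp_abs_convergent_prod)
    (auto simp: norm_mult norm_power intro!: summable_mult)

lemma q_pochhammer_tendsto: "q_pochhammer a q \<longlonglongrightarrow> q_pochhammer_inf a q"
proof -
  \<comment> \<open>\<open>convergent_prod_LIMSEQ\<close> concerns products over
    \<open>{..n}\<close>, which have \<open>Suc n\<close> factors.\<close>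
  have "(\<lambda>n. q_pochhammer a q (Suc n)) \<longlonglongrightarrow> q_pochhammer_inf a q"
    using convergent_prod_LIMSEQ[OF convergent_prod_q_pochhammer]
    by (simp add: q_pochhammer_def q_pochhammer_inf_def lessThan_Suc_atMost)
  then show ?thesis by (rule LIMSEQ_imp_Suc)
qed

lemma q_pochhammer_inf_nonzero: "norm a < 1 \<Longrightarrow> q_pochhammer_inf a q \<noteq> 0"
  unfolding q_pochhammer_inf_def
  using q_power_neq_1[of a] by (intro prodinf_nonzero convergent_prod_q_pochhammer) auto

lemma q_pochhammer_inf_split:
  "q_pochhammer_inf a q = q_pochhammer a q m * q_pochhammer_inf (a * complex_of_real q ^ m) q"
proof (rule LIMSEQ_unique)
  show "(\<lambda>n. q_pochhammer a q (n + m)) \<longlonglongrightarrow> q_pochhammer_inf a q"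
    by (rule LIMSEQ_ignore_initial_segment[OF q_pochhammer_tendsto])
  show "(\<lambda>n. q_pochhammer a q (n + m)) \<longlonglongrightarrow>
      q_pochhammer a q m * q_pochhammer_inf (a * complex_of_real q ^ m) q"
    unfolding add.commute[of _ m] q_pochhammer_add
    by (intro tendsto_intros q_pochhammer_tendsto)
qed

text \<open>Each factor is at most \<open>exp (norm z * q ^ j)\<close>, and the exponents add up to
  at most a full geometric series. The bound is independent of \<open>n\<close>, which later makes
  the kernel estimates uniform in \<open>j\<close>.\<close>

lemma norm_q_pochhammer_le: "norm (q_pochhammer z q n) \<le> exp (norm z / (1 - q))"
proof -
  have "norm (q_pochhammer z q n) \<le> (\<Prod>j<n. exp (norm z * q ^ j))"
    unfolding q_pochhammer_def prod_norm[symmetric]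
  proof (intro prod_mono conjI norm_ge_zero)
    fix j
    have "norm (1 - z * complex_of_real q ^ j) \<le> 1 + norm z * q ^ j"
      using norm_triangle_ineq4[of 1 "z * complex_of_real q ^ j"] q
      by (simp add: norm_mult norm_power)
    also have "\<dots> \<le> exp (norm z * q ^ j)" by (rule exp_ge_add_one_self)
    finally show "norm (1 - z * complex_of_real q ^ j) \<le> exp (norm z * q ^ j)" .
  qed
  also have "\<dots> = exp (norm z * (\<Sum>j<n. q ^ j))"
    by (simp add: exp_sum sum_distrib_left)
  also have "(\<Sum>j<n. q ^ j) \<le> 1 / (1 - q)"
    using sum_le_suminf[of "\<lambda>j. q ^ j" "{..<n}"] q by (simp add: suminf_geometric)
  then have "exp (norm z * (\<Sum>j<n. q ^ j)) \<le> exp (norm z / (1 - q))"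
    using mult_left_mono[of _ _ "norm z"] by fastforce
  finally show ?thesis by simp
qed

text \<open>The symbols converge to the nonzero number \<open>(q; q)\<^sub>\<infinity>\<close>, so
  their reciprocals converge and are bounded.\<close>

lemma q_pochhammer_q_inverse_bounded:
  obtains C where "0 < C" "\<And>n. norm (1 / q_pochhammer (complex_of_real q) q n) \<le> C"
proof -
  have "(\<lambda>n. inverse (q_pochhammer (complex_of_real q) q n)) \<longlonglongrightarrow>
      inverse (q_pochhammer_inf (complex_of_real q) q)"
    using q by (intro tendsto_inverse q_pochhammer_tendsto q_pochhammer_inf_nonzero) simp
  then have "Bseq (\<lambda>n. inverse (q_pochhammer (complex_of_real q) q n))"
    by (intro convergent_imp_Bseq convergentI)
  then obtain C where "0 < C" "\<And>n. norm (inverse (q_pochhammer (complex_of_real q) q n)) \<le> C"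
    by (auto elim: BseqE)
  then show ?thesis using that[of C] by (simp add: divide_inverse)
qed

text \<open>The Gaussian decay is weakened to a geometric one through
  \<open>n \<le> n(n+1)/2\<close>; a geometric majorant suffices for all later estimates.\<close>

lemma q_euler_coeff_bounded:
  obtains C where "0 < C" "\<And>n. norm (q_euler_coeff q n) \<le> C * q ^ n"
proof -
  obtain C where C: "0 < C" "\<And>n. norm (1 / q_pochhammer (complex_of_real q) q n) \<le> C"
    using q_pochhammer_q_inverse_bounded by metis
  have "norm (q_euler_coeff q n) \<le> C * q ^ n" for n
  proof -
    have "n \<le> n * (n + 1) div 2" by (cases n) auto
    then have "q ^ (n * (n + 1) div 2) \<le> q ^ n"
      using q by (intro power_decreasing) auto
    then have "norm (1 / q_pochhammer (complex_of_real q) q n) * q ^ (n * (n + 1) div 2) \<le> C * q ^ n"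
      using C q by (intro mult_mono) auto
    then show ?thesis
      using q by (simp add: q_euler_coeff_def norm_mult norm_divide norm_power)
  qed
  with C(1) show ?thesis by (rule that)
qed

text \<open>This is the coefficient form of the equation
  \<open>W y - W (q y) = - q y W (q y)\<close> for the generating function \<open>W\<close>.\<close>

lemma q_euler_coeff_Suc:
  "q_euler_coeff q (Suc n) * (1 - complex_of_real q ^ Suc n) =
     - (complex_of_real q ^ Suc n) * q_euler_coeff q n"
proof -
  have ne: "1 - complex_of_real q ^ Suc n \<noteq> 0"
    using q_power_neq_1[of "complex_of_real q" n] q by simp
  have "Suc n * (Suc n + 1) div 2 = n * (n + 1) div 2 + Suc n"
    by (simp add: algebra_simps)
  then have pow: "q ^ (Suc n * (Suc n + 1) div 2) = q ^ (n * (n + 1) div 2) * q ^ Suc n"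
    by (simp add: power_add)
  have poch: "q_pochhammer (complex_of_real q) q (Suc n) =
      q_pochhammer (complex_of_real q) q n * (1 - complex_of_real q ^ Suc n)"
    by (simp add: q_pochhammer_Suc)
  show ?thesis
    unfolding q_euler_coeff_def pow poch using ne by (simp add: field_simps)
qed

section \<open>Euler's two expansions\<close>

lemma q_power_tendsto_0: "(\<lambda>n. complex_of_real q ^ n * z) \<longlonglongrightarrow> 0"
  using q tendsto_mult[OF LIMSEQ_power_zero[of "complex_of_real q"] tendsto_const[of z]] by simp

text \<open>Both expansions are obtained by iterating a first order \<open>q\<close>-difference equation for the
  power series along \<open>z, q z, q\<^sup>2 z, \<dots>\<close> down to the origin.\<close>

lemma sums_inverse_q_pochhammer_inf:
  assumes z: "norm z < 1"
  shows "(\<lambda>k. z ^ k / q_pochhammer (complex_of_real q) q k) sums (1 / q_pochhammer_inf z q)"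
proof -
  define c where "c = (\<lambda>k. 1 / q_pochhammer (complex_of_real q) q k)"
  define e where "e = (\<lambda>z. \<Sum>k. c k * z ^ k)"
  obtain C where C: "\<And>n. norm (c n) \<le> C"
    unfolding c_def using q_pochhammer_q_inverse_bounded by metis
  have summ: "summable (\<lambda>k. c k * w ^ k)" if "norm w < 1" for w
  proof (rule summable_comparison_test'[OF summable_mult[OF summable_geometric, of "norm w" C]])
    show "norm (c n * w ^ n) \<le> C * norm w ^ n" for n
      unfolding norm_mult norm_power by (intro mult_right_mono C) auto
  qed (use that in auto)
  have lt: "norm (complex_of_real q * w) < 1" if "norm w < 1" for w
    using that q mult_strict_mono[of q 1 "norm w" 1] by (simp add: norm_mult)
  \<comment> \<open>Comparing coefficients, this amounts to
    \<open>c (Suc k) * (1 - q ^ Suc k) = c k\<close>.\<close>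
  have step: "e (complex_of_real q * w) = (1 - w) * e w" if w: "norm w < 1" for w
  proof -
    have "(\<lambda>k. c k * w ^ k - c k * (complex_of_real q * w) ^ k) sums (e w - e (complex_of_real q * w))"
      unfolding e_def by (intro sums_diff summable_sums summ w lt)
    moreover have "c (Suc k) * w ^ Suc k - c (Suc k) * (complex_of_real q * w) ^ Suc k =
        w * (c k * w ^ k)" for k
    proof -
      have "1 - complex_of_real q ^ Suc k \<noteq> 0"
        using q_power_neq_1[of "complex_of_real q" k] q by simp
      then have "c (Suc k) * (1 - complex_of_real q ^ Suc k) = c k"
        by (simp add: c_def q_pochhammer_Suc)
      then have "w * (c k * w ^ k) = w * (c (Suc k) * (1 - complex_of_real q ^ Suc k) * w ^ k)"
        by simp
      then show ?thesis by (simp add: power_mult_distrib algebra_simps)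
    qed
    moreover have "(\<lambda>k. w * (c k * w ^ k)) sums (w * e w)"
      unfolding e_def by (intro sums_mult summable_sums summ w)
    \<comment> \<open>The difference series has zero term at \<open>k = 0\<close>, so the index
      shift adds nothing.\<close>
    ultimately have "e w - e (complex_of_real q * w) = w * e w"
      using sums_Suc[of "\<lambda>k. c k * w ^ k - c k * (complex_of_real q * w) ^ k" "w * e w"]
      by (simp add: sums_unique2)
    then show ?thesis by (simp add: algebra_simps)
  qed
  have iter: "norm (complex_of_real q ^ n * z) < 1 \<and>
      e (complex_of_real q ^ n * z) = q_pochhammer z q n * e z" for n
  proof (induction n)
    case (Suc n)
    then show ?case
      using lt[of "complex_of_real q ^ n * z"] step[of "complex_of_real q ^ n * z"]
      by (simp add: q_pochhammer_Suc mult_ac)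
  qed (use z in auto)
  have "isCont e 0"
    unfolding e_def using summ[of "1/2"] by (rule isCont_powser) auto
  then have "(\<lambda>n. e (complex_of_real q ^ n * z)) \<longlonglongrightarrow> e 0"
    using q_power_tendsto_0 by (rule isCont_tendsto_compose)
  moreover have "e 0 = 1" unfolding e_def powser_zero by (simp add: c_def)
  moreover have "(\<lambda>n. e (complex_of_real q ^ n * z)) \<longlonglongrightarrow> q_pochhammer_inf z q * e z"
    using iter by (auto intro!: tendsto_intros q_pochhammer_tendsto)
  ultimately have "q_pochhammer_inf z q * e z = 1"
    using LIMSEQ_unique by metis
  \<comment> \<open>The product being 1 already forces \<open>q_pochhammer_inf z q\<close> to be
    nonzero.\<close>
  then have "e z = 1 / q_pochhammer_inf z q"
    by (metis mult_zero_left nonzero_mult_div_cancel_left zero_neq_one)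
  then show ?thesis
    using summable_sums[OF summ[OF z]] by (simp add: e_def c_def)
qed

lemma sums_q_pochhammer_inf:
  assumes z: "norm z \<le> 1"
  shows "(\<lambda>n. q_euler_coeff q n * z ^ n) sums q_pochhammer_inf (complex_of_real q * z) q"
proof -
  define w where "w = q_euler_coeff q"
  define W where "W = (\<lambda>z. \<Sum>k. w k * z ^ k)"
  obtain C where C: "0 < C" "\<And>n. norm (w n) \<le> C * q ^ n"
    unfolding w_def using q_euler_coeff_bounded by metis
  have summ: "summable (\<lambda>k. w k * y ^ k)" if "norm y \<le> 1" for y
  proof (rule summable_comparison_test'[OF summable_mult[OF summable_geometric, of q C]])
    show "norm (w n * y ^ n) \<le> C * q ^ n" for n
      using mult_mono[OF C(2)[of n] power_le_one[OF norm_ge_zero that, of n]] C q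
      by (simp add: norm_mult norm_power)
  qed (use q in auto)
  have le: "norm (complex_of_real q * y) \<le> 1" if "norm y \<le> 1" for y
    using that q mult_mono[of q 1 "norm y" 1] by (simp add: norm_mult)
  have step: "W y = (1 - complex_of_real q * y) * W (complex_of_real q * y)" if y: "norm y \<le> 1" for y
  proof -
    have "(\<lambda>k. w k * y ^ k - w k * (complex_of_real q * y) ^ k) sums (W y - W (complex_of_real q * y))"
      unfolding W_def by (intro sums_diff summable_sums summ y le)
    moreover have "w (Suc k) * y ^ Suc k - w (Suc k) * (complex_of_real q * y) ^ Suc k =
        - (complex_of_real q * y) * (w k * (complex_of_real q * y) ^ k)" for k
    proof -
      have "w (Suc k) * y ^ Suc k - w (Suc k) * (complex_of_real q * y) ^ Suc k =
          (w (Suc k) * (1 - complex_of_real q ^ Suc k)) * y ^ Suc k"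
        by (simp add: power_mult_distrib algebra_simps)
      also have "\<dots> = - (complex_of_real q * y) * (w k * (complex_of_real q * y) ^ k)"
        unfolding w_def q_euler_coeff_Suc by (simp add: power_mult_distrib)
      finally show ?thesis .
    qed
    moreover have "(\<lambda>k. - (complex_of_real q * y) * (w k * (complex_of_real q * y) ^ k)) sums
        (- (complex_of_real q * y) * W (complex_of_real q * y))"
      unfolding W_def by (intro sums_mult summable_sums summ y le)
    ultimately have "W y - W (complex_of_real q * y) =
        - (complex_of_real q * y) * W (complex_of_real q * y)"
      using sums_Suc[of "\<lambda>k. w k * y ^ k - w k * (complex_of_real q * y) ^ k"
          "- (complex_of_real q * y) * W (complex_of_real q * y)"]
      by (simp only: power_0 diff_self add_0_right sums_unique2)
    then show ?thesis by (simp add: algebra_simps)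
  qed
  \<comment> \<open>The equation now expresses \<open>W\<close> at a point through its value nearer
    the origin, so \<open>W z\<close> stays fixed while the other factors converge to
    \<open>(q z; q)\<^sub>\<infinity>\<close> and \<open>W 0 = 1\<close>.\<close>
  have iter: "norm (complex_of_real q ^ n * z) \<le> 1 \<and>
      W z = q_pochhammer (complex_of_real q * z) q n * W (complex_of_real q ^ n * z)" for n
  proof (induction n)
    case (Suc n)
    then show ?case
      using le[of "complex_of_real q ^ n * z"] step[of "complex_of_real q ^ n * z"]
      by (simp add: q_pochhammer_Suc mult_ac)
  qed (use z in auto)
  have "isCont W 0"
    unfolding W_def using summ[of 1] by (rule isCont_powser) auto
  then have "(\<lambda>n. W (complex_of_real q ^ n * z)) \<longlonglongrightarrow> W 0"
    using q_power_tendsto_0 by (rule isCont_tendsto_compose)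
  then have "(\<lambda>n. q_pochhammer (complex_of_real q * z) q n * W (complex_of_real q ^ n * z))
      \<longlonglongrightarrow> q_pochhammer_inf (complex_of_real q * z) q * W 0"
    by (intro tendsto_intros q_pochhammer_tendsto)
  then have "(\<lambda>n. W z) \<longlonglongrightarrow> q_pochhammer_inf (complex_of_real q * z) q * W 0"
    by (rule Lim_transform_eventually[OF _ always_eventually[OF allI[OF sym[OF conjunct2[OF iter]]]]])
  moreover have "W 0 = 1" unfolding W_def powser_zero by (simp add: w_def)
  ultimately have "W z = q_pochhammer_inf (complex_of_real q * z) q"
    using LIMSEQ_unique[OF tendsto_const] by fastforce
  then show ?thesis
    using summable_sums[OF summ[OF z]] by (simp add: W_def w_def)
qed

section \<open>The kernel series\<close>

text \<open>The decay of the Euler coefficients is combined with the exponential bound on the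
  symbols. One constant \<open>C\<close> serves all \<open>R\<close>, \<open>n\<close>,
  \<open>j\<close> and \<open>z\<close>.\<close>

lemma q_Durrmeyer_kernel_bound:
  obtains C where "0 < C"
    "\<And>R n j z. norm z \<le> R \<Longrightarrow>
       norm (q_euler_coeff q n * q_pochhammer z q (n + j)) \<le> C * exp (R / (1 - q)) * q ^ n"
proof -
  obtain C where C: "0 < C" "\<And>n. norm (q_euler_coeff q n) \<le> C * q ^ n"
    using q_euler_coeff_bounded by metis
  have "norm (q_euler_coeff q n * q_pochhammer z q (n + j)) \<le> C * exp (R / (1 - q)) * q ^ n"
    if "norm z \<le> R" for R n j z
  proof -
    have "exp (norm z / (1 - q)) \<le> exp (R / (1 - q))"
      using that q by (simp add: divide_right_mono)
    then have "norm (q_pochhammer z q (n + j)) \<le> exp (R / (1 - q))"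
      using norm_q_pochhammer_le[of z "n + j"] by linarith
    then have "norm (q_euler_coeff q n) * norm (q_pochhammer z q (n + j))
        \<le> (C * q ^ n) * exp (R / (1 - q))"
      using C q by (intro mult_mono) auto
    then show ?thesis by (simp add: norm_mult mult_ac)
  qed
  with C(1) show ?thesis by (rule that)
qed

lemma summable_q_Durrmeyer_kernel: "summable (\<lambda>n. q_euler_coeff q n * q_pochhammer z q (n + j))"
proof -
  obtain C where C: "\<And>R n j z. norm z \<le> R \<Longrightarrow>
       norm (q_euler_coeff q n * q_pochhammer z q (n + j)) \<le> C * exp (R / (1 - q)) * q ^ n"
    using q_Durrmeyer_kernel_bound by metis
  show ?thesis
    by (rule summable_comparison_test'
          [OF summable_mult[OF summable_geometric, of q "C * exp (norm z / (1 - q))"]])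
       (use q in \<open>auto intro: C\<close>)
qed

lemma norm_q_Durrmeyer_kernel_le:
  obtains K where "0 \<le> K" "\<And>j z. norm z \<le> R \<Longrightarrow> norm (q_Durrmeyer_kernel q j z) \<le> K"
proof -
  obtain C where C: "0 < C" "\<And>R n j z. norm z \<le> R \<Longrightarrow>
       norm (q_euler_coeff q n * q_pochhammer z q (n + j)) \<le> C * exp (R / (1 - q)) * q ^ n"
    using q_Durrmeyer_kernel_bound by metis
  have summ: "summable (\<lambda>n. C * exp (R / (1 - q)) * q ^ n)"
    using q by (intro summable_mult summable_geometric) auto
  show ?thesis
  proof
    show "0 \<le> (\<Sum>n. C * exp (R / (1 - q)) * q ^ n)"
      using summ C q by (intro suminf_nonneg) auto
    show "norm (q_Durrmeyer_kernel q j z) \<le> (\<Sum>n. C * exp (R / (1 - q)) * q ^ n)"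
      if "norm z \<le> R" for j z
      unfolding q_Durrmeyer_kernel_def using C that summ by (intro suminf_le norm_suminf_le) auto
  qed
qed

lemma holomorphic_q_Durrmeyer_kernel: "q_Durrmeyer_kernel q j holomorphic_on UNIV"
  unfolding q_Durrmeyer_kernel_def
proof (rule entire_suminf)
  obtain C where C: "\<And>R n j z. norm z \<le> R \<Longrightarrow>
       norm (q_euler_coeff q n * q_pochhammer z q (n + j)) \<le> C * exp (R / (1 - q)) * q ^ n"
    using q_Durrmeyer_kernel_bound by metis
  show "\<exists>M. summable M \<and> (\<forall>n z. norm z \<le> R \<longrightarrow>
      norm (q_euler_coeff q n * q_pochhammer z q (n + j)) \<le> M n)" for R
    using q by (intro exI[of _ "\<lambda>n. C * exp (R / (1 - q)) * q ^ n"])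
      (auto intro: C summable_mult summable_geometric)
qed (intro holomorphic_intros)

text \<open>Since \<open>(1; q)\<^sub>m\<close> vanishes for positive \<open>m\<close>, a term
  survives only for \<open>n = j = 0\<close>.\<close>

lemma q_Durrmeyer_kernel_one: "q_Durrmeyer_kernel q j 1 = (if j = 0 then 1 else 0)"
proof -
  have "q_euler_coeff q n * q_pochhammer 1 q (n + j) = (if n = 0 \<and> j = 0 then 1 else 0)" for n
    by (cases "n + j") (auto simp: q_pochhammer_one_Suc)
  then have "q_Durrmeyer_kernel q j 1 = (\<Sum>n. if n = 0 \<and> j = 0 then 1 else 0)"
    by (simp add: q_Durrmeyer_kernel_def)
  also have "\<dots> = (if j = 0 then 1 else 0)"
    using suminf_finite[of "{0}" "\<lambda>n. if n = 0 \<and> j = 0 then 1 else (0::complex)"] by auto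
  finally show ?thesis .
qed

text \<open>The factor \<open>(q; q)\<^sub>\<infinity> / (q; q)\<^sub>k\<close> equals \<open>(q\<^bsup>k+1\<^esup>; q)\<^sub>\<infinity>\<close>; expanding it by the second of
  Euler's identities leaves a sum over \<open>k\<close> that the first one evaluates.\<close>

lemma q_Durrmeyer_kernel_eq:
  assumes x: "norm x < 1"
  shows "q_pochhammer_inf x q *
      (\<Sum>k. q_pochhammer_inf (complex_of_real q) q / q_pochhammer (complex_of_real q) q k
           * (x * complex_of_real q ^ j) ^ k / q_pochhammer (complex_of_real q) q k)
    = q_Durrmeyer_kernel q j x"
proof -
  define Q where "Q = complex_of_real q"
  define P where "P = q_pochhammer Q q"
  define w where "w = q_euler_coeff q"
  define y where "y = x * Q ^ j"
  have P_nz: "P k \<noteq> 0" for k by (simp add: P_def Q_def)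
  have nQ: "norm (Q ^ n) \<le> 1" for n
    using q by (simp add: Q_def norm_power power_le_one)
  have y_le: "norm y \<le> norm x"
    using mult_left_mono[OF nQ[of j], of "norm x"] by (simp add: y_def norm_mult)
  obtain C where C: "0 < C" "\<And>n. norm (1 / P n) \<le> C"
    unfolding P_def Q_def using q_pochhammer_q_inverse_bounded by metis
  obtain C' where C': "0 < C'" "\<And>n. norm (w n) \<le> C' * q ^ n"
    unfolding w_def using q_euler_coeff_bounded by metis
  \<comment> \<open>The second Euler expansion at \<open>Q ^ k\<close> has value
    \<open>(q * q ^ k; q)\<^sub>\<infinity>\<close>, which the splitting of the infinite product
    turns into this quotient.\<close>
  have euler2: "(\<lambda>n. w n * (Q ^ k) ^ n) sums (q_pochhammer_inf Q q / P k)" for k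
    using sums_q_pochhammer_inf[OF nQ[of k]] q_pochhammer_inf_split[of Q k] P_nz[of k]
    by (simp add: P_def Q_def w_def)
  have euler1: "(\<lambda>k. (y * Q ^ n) ^ k / P k) sums (1 / q_pochhammer_inf (x * Q ^ (n + j)) q)" for n
  proof -
    have "norm (y * Q ^ n) < 1"
      using mult_left_mono[OF nQ[of n], of "norm y"] y_le x by (simp add: norm_mult)
    then show ?thesis
      using sums_inverse_q_pochhammer_inf[of "y * Q ^ n"]
      by (simp add: P_def Q_def y_def power_add mult_ac)
  qed
  have "(\<Sum>k. q_pochhammer_inf Q q / P k * y ^ k / P k) = (\<Sum>k. \<Sum>n. w n * (Q ^ k) ^ n * (y ^ k / P k))"
  proof -
    have "q_pochhammer_inf Q q / P k * (y ^ k / P k) = (\<Sum>n. w n * (Q ^ k) ^ n * (y ^ k / P k))" for k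
      by (rule sums_unique[OF sums_mult2[OF euler2]])
    then show ?thesis by (simp only: times_divide_eq_right)
  qed
  also have "\<dots> = (\<Sum>n. \<Sum>k. w n * (Q ^ k) ^ n * (y ^ k / P k))"
  proof (rule suminf_swap_dominated[where u = "\<lambda>k. C * norm x ^ k" and v = "\<lambda>n. C' * q ^ n"])
    fix k n
    have "norm (w n * (Q ^ k) ^ n) \<le> C' * q ^ n * 1"
      unfolding norm_mult by (intro mult_mono C') (use C' q nQ[of "k * n"] in \<open>auto simp: power_mult\<close>)
    moreover have "norm (y ^ k / P k) \<le> norm x ^ k * C"
      using mult_mono[OF power_mono[OF y_le norm_ge_zero, of k] C(2)[of k]]
      by (simp add: norm_divide norm_power)
    ultimately have "norm (w n * (Q ^ k) ^ n) * norm (y ^ k / P k) \<le> (C' * q ^ n * 1) * (norm x ^ k * C)"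
      using C' q by (intro mult_mono) auto
    then show "norm (w n * (Q ^ k) ^ n * (y ^ k / P k)) \<le> C * norm x ^ k * (C' * q ^ n)"
      by (simp only: norm_mult mult_1_right mult_ac)
  qed (use C C' q x in \<open>auto intro!: summable_mult summable_geometric\<close>)
  also have "\<dots> = (\<Sum>n. w n * (1 / q_pochhammer_inf (x * Q ^ (n + j)) q))"
  proof -
    \<comment> \<open>Regrouping the powers makes the inner sum over \<open>k\<close> the first
      Euler series at \<open>y * Q ^ n\<close>.\<close>
    have "w n * (Q ^ k) ^ n * (y ^ k / P k) = w n * ((y * Q ^ n) ^ k / P k)" for k n
    proof -
      have "(Q ^ k) ^ n = (Q ^ n) ^ k" by (metis power_mult mult.commute)
      then show ?thesis by (simp add: power_mult_distrib)
    qed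
    then show ?thesis
      by (simp only: sums_unique[OF sums_mult[OF euler1], symmetric])
  qed
  finally have eq: "(\<Sum>k. q_pochhammer_inf Q q / P k * y ^ k / P k) =
      (\<Sum>n. w n * (1 / q_pochhammer_inf (x * Q ^ (n + j)) q))" .
  have inf_nz: "q_pochhammer_inf x q \<noteq> 0" by (rule q_pochhammer_inf_nonzero[OF x])
  \<comment> \<open>The prefactor turns each reciprocal infinite product into a finite symbol, which
    is defined for all complex arguments and gives the continuation.\<close>
  have quot: "q_pochhammer x q m = q_pochhammer_inf x q * (1 / q_pochhammer_inf (x * Q ^ m) q)" for m
    using q_pochhammer_inf_split[of x m] inf_nz by (auto simp: Q_def)
  have "(\<lambda>n. w n * q_pochhammer x q (n + j) / q_pochhammer_inf x q) sums
      (q_Durrmeyer_kernel q j x / q_pochhammer_inf x q)"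
    unfolding q_Durrmeyer_kernel_def w_def
    by (intro sums_divide summable_sums summable_q_Durrmeyer_kernel)
  then have "(\<Sum>n. w n * (1 / q_pochhammer_inf (x * Q ^ (n + j)) q)) =
      q_Durrmeyer_kernel q j x / q_pochhammer_inf x q"
    unfolding quot using inf_nz by (simp add: sums_iff)
  then show ?thesis
    using eq inf_nz by (simp add: P_def Q_def y_def)
qed

section \<open>The limit q-Durrmeyer operator\<close>

text \<open>Continuity on the compact interval bounds \<open>f\<close> at the nodes
  \<open>q ^ j\<close>; the geometric decay is the factor \<open>q ^ j\<close> of the Jackson
  integral.\<close>

lemma q_Durrmeyer_weight_bounded:
  assumes "continuous_on {0..1} f"
  obtains B where "0 < B" "\<And>j. norm (q_Durrmeyer_weight q f j) \<le> B * q ^ j"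
proof -
  have "bounded (f ` {0..1})"
    by (intro compact_imp_bounded compact_continuous_image assms compact_Icc)
  then obtain A where A: "0 < A" "\<And>t. t \<in> {0..1} \<Longrightarrow> norm (f t) \<le> A"
    by (auto simp: bounded_pos)
  obtain C where C: "0 < C" "\<And>n. norm (1 / q_pochhammer (complex_of_real q) q n) \<le> C"
    using q_pochhammer_q_inverse_bounded by metis
  have "norm (q_Durrmeyer_weight q f j) \<le> A * C * q ^ j" for j
  proof -
    have "norm (f (q ^ j)) * norm (1 / q_pochhammer (complex_of_real q) q j) \<le> A * C"
      using q A C by (intro mult_mono) (auto simp: power_le_one)
    then have "norm (f (q ^ j)) * norm (1 / q_pochhammer (complex_of_real q) q j) * q ^ j \<le> A * C * q ^ j"
      using q by (intro mult_right_mono) auto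
    then show ?thesis
      using q by (simp add: q_Durrmeyer_weight_def norm_mult norm_divide norm_power)
  qed
  with A C show ?thesis by (intro that[of "A * C"]) auto
qed

text \<open>At the node \<open>q ^ j\<close> the basis function contains
  \<open>(q * q ^ j; q)\<^sub>\<infinity>\<close>, that is \<open>(q; q)\<^sub>\<infinity>\<close>
  divided by \<open>(q; q)\<^sub>j\<close>. This supplies the denominator of the weight.\<close>

lemma limit_q_Durrmeyer_coeff_eq:
  assumes "continuous_on {0..1} f"
  shows "limit_q_Durrmeyer_coeff q k f = (\<Sum>j. q_Durrmeyer_weight q f j *
    (q_pochhammer_inf (complex_of_real q) q * (complex_of_real q ^ j) ^ k / q_pochhammer (complex_of_real q) q k))"
proof -
  define Q where "Q = complex_of_real q"
  define P where "P = q_pochhammer Q q"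
  define c where "c = q_Durrmeyer_weight q f"
  define I where "I = q_pochhammer_inf Q q"
  have Q0: "Q \<noteq> 0" using q by (simp add: Q_def)
  have P_nz: "P k \<noteq> 0" for k by (simp add: P_def Q_def)
  have I: "q_pochhammer_inf (Q * Q ^ j) q = I / P j" for j
    using q_pochhammer_inf_split[of Q j] P_nz[of j] by (simp add: I_def P_def Q_def)
  obtain B where B: "0 < B" "\<And>j. norm (c j) \<le> B * q ^ j"
    unfolding c_def using q_Durrmeyer_weight_bounded[OF assms] by metis
  have summ: "summable (\<lambda>j. c j * (I * (Q ^ j) ^ k / P k))"
  proof (rule summable_comparison_test'[OF summable_mult[OF summable_geometric, of q "B * norm (I / P k)"]])
    fix j
    have "norm ((Q ^ j) ^ k) \<le> 1"
      using q by (simp add: Q_def norm_power power_le_one)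
    then have "norm (c j) * norm ((Q ^ j) ^ k) \<le> B * q ^ j * 1"
      using B q by (intro mult_mono) auto
    then have "norm (c j) * norm ((Q ^ j) ^ k) * norm (I / P k) \<le> B * q ^ j * 1 * norm (I / P k)"
      by (intro mult_right_mono) auto
    then show "norm (c j * (I * (Q ^ j) ^ k / P k)) \<le> B * norm (I / P k) * q ^ j"
      by (simp add: norm_mult norm_divide mult_ac)
  qed (use q in auto)
  have "complex_of_real (q ^ j) * (f (1 * q ^ j) * limit_q_basis q k (q * (1 * q ^ j))) =
      Q ^ k * (c j * (I * (Q ^ j) ^ k / P k))" for j
  proof -
    have "limit_q_basis q k (q * (1 * q ^ j)) = (I / P j) * (Q * Q ^ j) ^ k / P k"
      using I[of j] by (simp add: limit_q_basis_def Q_def P_def)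
    then show ?thesis
      by (simp add: c_def q_Durrmeyer_weight_def Q_def[symmetric] P_def[symmetric]
          power_mult_distrib mult_ac)
  qed
  then have "(\<Sum>j. complex_of_real (q ^ j) * (f (1 * q ^ j) * limit_q_basis q k (q * (1 * q ^ j)))) =
      Q ^ k * (\<Sum>j. c j * (I * (Q ^ j) ^ k / P k))"
    by (simp only: suminf_mult[OF summ])
  \<comment> \<open>The normalisation of the coefficient cancels the factor of the Jackson integral
    and the \<open>Q ^ k\<close> from evaluating the basis at \<open>q t\<close>.\<close>
  moreover have "complex_of_real (q powi (- int k) / (1 - q)) * complex_of_real ((1 - q) * 1) * Q ^ k = 1"
    using q Q0 by (simp add: Q_def power_int_minus field_simps)
  ultimately show ?thesis
    unfolding limit_q_Durrmeyer_coeff_def q_integral_def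
    by (simp add: c_def I_def P_def Q_def mult.assoc[symmetric])
qed

text \<open>Inserting the coefficients gives a double series that may be interchanged:
  \<open>x < 1\<close> gives geometric decay in \<open>k\<close>, the weights give it in
  \<open>j\<close>. The sum over \<open>k\<close> is then the kernel.\<close>

lemma limit_q_Durrmeyer_eq:
  assumes f: "continuous_on {0..1} f" and x: "0 \<le> x" "x < 1"
  shows "limit_q_Durrmeyer q f x = (\<Sum>j. q_Durrmeyer_weight q f j * q_Durrmeyer_kernel q j (complex_of_real x))"
proof -
  define Q where "Q = complex_of_real q"
  define X where "X = complex_of_real x"
  define P where "P = q_pochhammer Q q"
  define c where "c = q_Durrmeyer_weight q f"
  define I where "I = q_pochhammer_inf Q q"
  define J where "J = q_pochhammer_inf X q"
  have nX: "norm X = x" using x by (simp add: X_def)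
  obtain C where C: "0 < C" "\<And>n. norm (1 / P n) \<le> C"
    unfolding P_def Q_def using q_pochhammer_q_inverse_bounded by metis
  obtain B where B: "0 < B" "\<And>j. norm (c j) \<le> B * q ^ j"
    unfolding c_def using q_Durrmeyer_weight_bounded[OF f] by metis
  define T where "T = (\<lambda>j k. J * (I / P k * (X * Q ^ j) ^ k / P k))"
  \<comment> \<open>One \<open>C\<close> bounds the denominator of the basis function, the other
    that of the coefficient.\<close>
  define D where "D = norm J * norm I * C * C"
  have D: "0 \<le> D" using C by (simp add: D_def)
  have T_le: "norm (T j k) \<le> D * x ^ k" for j k
  proof -
    have "norm ((Q ^ j) ^ k) \<le> 1"
      using q by (simp add: Q_def norm_power power_le_one)
    then have "norm (X ^ k * (Q ^ j) ^ k) \<le> x ^ k * 1"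
      unfolding norm_mult norm_power[of X] nX using x by (intro mult_left_mono) auto
    moreover have "norm (1 / P k) * norm (1 / P k) \<le> C * C"
      using C by (intro mult_mono) auto
    ultimately have "norm (1 / P k) * norm (1 / P k) * norm (X ^ k * (Q ^ j) ^ k) \<le> C * C * (x ^ k * 1)"
      using C by (intro mult_mono) auto
    then have "(norm J * norm I) * (norm (1 / P k) * norm (1 / P k) * norm (X ^ k * (Q ^ j) ^ k))
        \<le> (norm J * norm I) * (C * C * (x ^ k * 1))"
      by (intro mult_left_mono) auto
    then show ?thesis
      by (simp add: T_def D_def norm_mult norm_divide power_mult_distrib mult_ac)
  qed
  have T_summ: "summable (T j)" for j
    by (rule summable_comparison_test'[OF summable_mult[OF summable_geometric, of x D]])
       (use x T_le in auto)
  have cT_summ: "summable (\<lambda>j. c j * T j k)" for k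
  proof (rule summable_comparison_test'[OF summable_mult[OF summable_geometric, of q "B * (D * x ^ k)"]])
    show "norm (c j * T j k) \<le> B * (D * x ^ k) * q ^ j" for j
      using mult_mono[OF B(2)[of j] T_le[of j k]] B q by (simp add: norm_mult mult_ac)
  qed (use q in auto)
  have term_eq: "limit_q_Durrmeyer_coeff q k f * limit_q_basis q k x = (\<Sum>j. c j * T j k)" for k
  \<comment> \<open>Summability of the coefficient series is obtained by cancelling the basis value,
    which does vanish for \<open>x = 0\<close> and positive \<open>k\<close>; both sides are then
    0.\<close>
  proof (cases "limit_q_basis q k x = 0")
    case True
    then have "T j k = 0" for j
      by (auto simp: T_def J_def P_def Q_def X_def limit_q_basis_def)
    then show ?thesis using True by simp
  next
    case False
    have eq: "c j * T j k = limit_q_basis q k x * (c j * (I * (Q ^ j) ^ k / P k))" for j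
      by (simp add: T_def limit_q_basis_def J_def P_def Q_def X_def power_mult_distrib)
    have summ: "summable (\<lambda>j. c j * (I * (Q ^ j) ^ k / P k))"
      using cT_summ[of k] False unfolding eq summable_cmult_iff by blast
    have coeff: "limit_q_Durrmeyer_coeff q k f = (\<Sum>j. c j * (I * (Q ^ j) ^ k / P k))"
      unfolding limit_q_Durrmeyer_coeff_eq[OF f] c_def I_def P_def Q_def ..
    show ?thesis
      unfolding eq suminf_mult[OF summ] coeff by (rule mult.commute)
  qed
  have "limit_q_Durrmeyer q f x = (\<Sum>k. \<Sum>j. c j * T j k)"
    using x by (simp add: limit_q_Durrmeyer_def term_eq)
  also have "\<dots> = (\<Sum>j. \<Sum>k. c j * T j k)"
  proof (rule suminf_swap_dominated[where u = "\<lambda>k. D * x ^ k" and v = "\<lambda>j. B * q ^ j"])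
    show "norm (c j * T j k) \<le> D * x ^ k * (B * q ^ j)" for k j
      using mult_mono[OF B(2)[of j] T_le[of j k]] B q by (simp add: norm_mult mult_ac)
  qed (use B D q x in \<open>auto intro!: summable_mult summable_geometric\<close>)
  also have "\<dots> = (\<Sum>j. c j * q_Durrmeyer_kernel q j X)"
  proof -
    have "(\<Sum>k. T j k) = q_Durrmeyer_kernel q j X" for j
    proof (cases "J = 0")
      case False
      then have "summable (\<lambda>k. I / P k * (X * Q ^ j) ^ k / P k)"
        using T_summ[of j] unfolding T_def summable_cmult_iff by blast
      then have "(\<Sum>k. T j k) = J * (\<Sum>k. I / P k * (X * Q ^ j) ^ k / P k)"
        unfolding T_def by (rule suminf_mult)
      then show ?thesis
        using q_Durrmeyer_kernel_eq[of X j] x nX by (simp only: J_def I_def P_def Q_def)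
    next
      case True
      then show ?thesis
        using q_pochhammer_inf_nonzero[of X] x nX by (simp add: J_def)
    qed
    then show ?thesis using suminf_mult[OF T_summ] by simp
  qed
  finally show ?thesis by (simp add: c_def X_def)
qed

text \<open>On \<open>norm z \<le> R\<close> the kernels have a common bound \<open>K\<close>, so
  \<open>B * q ^ j * K\<close> is a summable majorant of the outer series.\<close>

lemma limit_q_Durrmeyer_entire:
  assumes f: "continuous_on {0..1} f"
  defines "F \<equiv> \<lambda>z. \<Sum>j. q_Durrmeyer_weight q f j * q_Durrmeyer_kernel q j z"
  shows "F holomorphic_on UNIV"
    and "(\<lambda>j. q_Durrmeyer_weight q f j * q_Durrmeyer_kernel q j z) sums F z"
    and "x \<in> {0..1} \<Longrightarrow> F (complex_of_real x) = limit_q_Durrmeyer q f x"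
proof -
  obtain B where B: "0 < B" "\<And>j. norm (q_Durrmeyer_weight q f j) \<le> B * q ^ j"
    using q_Durrmeyer_weight_bounded[OF f] by metis
  have bound: "\<exists>M. summable M \<and> (\<forall>j z. norm z \<le> R \<longrightarrow>
      norm (q_Durrmeyer_weight q f j * q_Durrmeyer_kernel q j z) \<le> M j)" for R
  proof -
    obtain K where K: "0 \<le> K" "\<And>j z. norm z \<le> R \<Longrightarrow> norm (q_Durrmeyer_kernel q j z) \<le> K"
      using norm_q_Durrmeyer_kernel_le[of R] by metis
    have "norm (q_Durrmeyer_weight q f j * q_Durrmeyer_kernel q j z) \<le> B * q ^ j * K"
      if "norm z \<le> R" for j z
      unfolding norm_mult using B q K that by (intro mult_mono) auto
    moreover have "summable (\<lambda>j. B * q ^ j * K)"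
      using q by (intro summable_mult2 summable_mult summable_geometric) auto
    ultimately show ?thesis by blast
  qed
  show "F holomorphic_on UNIV"
    unfolding F_def
    by (rule entire_suminf[OF _ bound])
       (intro holomorphic_intros holomorphic_q_Durrmeyer_kernel)
  show "(\<lambda>j. q_Durrmeyer_weight q f j * q_Durrmeyer_kernel q j z) sums F z"
  proof -
    obtain M where M: "summable M" "\<And>j. norm (q_Durrmeyer_weight q f j * q_Durrmeyer_kernel q j z) \<le> M j"
      using bound[of "norm z"] by blast
    then show ?thesis
      unfolding F_def by (intro summable_sums) (rule summable_comparison_test'[OF M])
  qed
  show "F (complex_of_real x) = limit_q_Durrmeyer q f x" if "x \<in> {0..1}"
  proof (cases "x = 1")
    case True
    \<comment> \<open>Only the node \<open>q ^ 0 = 1\<close> contributes, which matches the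
      separately defined value of the operator at 1.\<close>
    have "F 1 = (\<Sum>j. if j = 0 then f 1 else 0)"
      unfolding F_def q_Durrmeyer_kernel_one
      by (intro arg_cong[where f = suminf]) (auto simp: q_Durrmeyer_weight_def)
    also have "\<dots> = f 1"
      using suminf_finite[of "{0}" "\<lambda>j::nat. if j = 0 then f 1 else 0"] by simp
    finally show ?thesis using True by (simp add: limit_q_Durrmeyer_def)
  next
    case False
    then show ?thesis using that limit_q_Durrmeyer_eq[OF f, of x] by (simp add: F_def)
  qed
qed

end

text \<open>Convergence is part of the claim, through \<open>summable\<close> for the inner series
  and \<open>sums\<close> for the outer one, so the formula does not rest on the value of
  \<open>suminf\<close> at a divergent series.\<close>

theorem theorem2p1:
  fixes q :: real and f :: "real \<Rightarrow> complex"
  assumes "0 < q" and "q < 1"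
    and "continuous_on {0..1} f"
  shows "\<exists>F :: complex \<Rightarrow> complex.
    F holomorphic_on UNIV \<and>
    (\<forall>x\<in>{0..1}. F (complex_of_real x) = limit_q_Durrmeyer q f x) \<and>
    (\<forall>z. (\<forall>j. summable (\<lambda>n. (-1) ^ n * complex_of_real (q ^ (n * (n + 1) div 2))
                  / q_pochhammer (complex_of_real q) q n * q_pochhammer z q (n + j))) \<and>
         (\<lambda>j. f (q ^ j) * complex_of_real (q ^ j) / q_pochhammer (complex_of_real q) q j
            * (\<Sum>n. (-1) ^ n * complex_of_real (q ^ (n * (n + 1) div 2))
                  / q_pochhammer (complex_of_real q) q n * q_pochhammer z q (n + j)))
           sums F z)"
  using limit_q_Durrmeyer_entire[OF assms] summable_q_Durrmeyer_kernel[OF assms(1,2)]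
  unfolding q_Durrmeyer_kernel_def q_Durrmeyer_weight_def q_euler_coeff_def
  by blast

end
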